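(* Let $\mathcal V$ be a multivector field on $X$, let $S$ be an isolated invariant set, and let $P=(P_1,P_2)$ and $Q=(Q_1,Q_2)$ be two index pairs for $S$. Then $H(P_1,P_2)\cong H(Q_1,Q_2)$. (Consequently the homology Conley index $\operatorname{Con}(S):=H(P_1,P_2)$ is well defined.)
   Context: $X$ is a finite $T_0$ topological space. For $A\subset X$, $\operatorname{cl}A$ is its closure and $\operatorname{mo}A:=\operatorname{cl}A\setminus A$. $A$ is locally closed if it is the intersection of an open and a closed subset of $X$. $H$ denotes relative singular homology. A multivector is a nonempty locally closed subset of $X$; a multivector field $\mathcal V$ on $X$ is a partition of $X$ into multivectors. For $x\in X$, $[x]$ denotes the element of $\mathcal V$ containing $x$. A multivector $V$ is critical if $H(\operatorname{cl}V,\operatorname{mo}V)\neq0$, regular otherwise. Put $\Pi_{\mathcal V}(x):=[x]\cup\operatorname{cl}\{x\}$ and $\Pi_{\mathcal V}(A):=\bigcup_{x\in A}\Pi_{\mathcal V}(x)$. A $\mathbb Z$-interval is $\mathbb Z\cap I$ for a real interval $I$. A solution in $A\subset X$ is a map $\varphi:D\to A$ on a $\mathbb Z$-interval $D$ with $\varphi(i+1)\in\Pi_{\mathcal V}(\varphi(i))$ whenever $i,i+1\in D$; it is full if $D=\mathbb Z$, and a path if $D$ is bounded, its endpoints being $\varphi(\min D)$ and $\varphi(\max D)$. A full solution $\varphi$ is essential if for every $t\in\mathbb Z$ with $[\varphi(t)]$ regular, the set $\{s\in\mathbb Z:\varphi(s)\notin[\varphi(t)]\}$ is unbounded below and unbounded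 above. $\operatorname{Inv}A$ is the set of $x\in A$ such that there is an essential full solution $\varphi$ with image in $A$ and $\varphi(0)=x$; $A$ is invariant if $\operatorname{Inv}A=A$. A closed set $N$ isolates an invariant set $S\subset N$ if (a) every path in $N$ with both endpoints in $S$ has image contained in $S$, and (b) $\Pi_{\mathcal V}(S)\subset N$. An invariant set is an isolated invariant set if some closed set isolates it. An index pair for an isolated invariant set $S$ is a pair $(P_1,P_2)$ of closed subsets of $X$ with $P_2\subset P_1$ such that (IP1) if $x\in P_2$ and $y\in\Pi_{\mathcal V}(x)\cap P_1$ then $y\in P_2$; (IP2) if $x\in P_1$ and $\Pi_{\mathcal V}(x)\setminus P_1\neq\emptyset$ then $x\in P_2$; (IP3) $S=\operatorname{Inv}(P_1\setminus P_2)$. *)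

theory Defs
  imports "HOL-Homology.Homology" "HOL-Analysis.Abstract_Topological_Spaces"
begin

text \<open>Setting: a finite T0 topological space T (the paper's X = topspace T).\<close>

definition mouth :: "'a topology \<Rightarrow> 'a set \<Rightarrow> 'a set" where
  "mouth T A = (T closure_of A) - A"

definition locally_closed_in :: "'a topology \<Rightarrow> 'a set \<Rightarrow> bool" where
  "locally_closed_in T A \<longleftrightarrow> (\<exists>U C. openin T U \<and> closedin T C \<and> A = U \<inter> C)"

definition multivector :: "'a topology \<Rightarrow> 'a set \<Rightarrow> bool" where
  "multivector T A \<longleftrightarrow> A \<noteq> {} \<and> locally_closed_in T A"

definition multivector_field :: "'a topology \<Rightarrow> 'a set set \<Rightarrow> bool" where
  "multivector_field T V \<longleftrightarrow>
     \<Union>V = topspace T \<and> (\<forall>A\<in>V. multivector T A) \<and>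
     (\<forall>A\<in>V. \<forall>B\<in>V. A \<noteq> B \<longrightarrow> A \<inter> B = {})"

definition mvclass :: "'a set set \<Rightarrow> 'a \<Rightarrow> 'a set" where
  "mvclass V x = (THE A. A \<in> V \<and> x \<in> A)"

definition critical :: "'a topology \<Rightarrow> 'a set \<Rightarrow> bool" where
  "critical T A \<longleftrightarrow>
     (\<exists>p. \<not> trivial_group
            (relative_homology_group p (subtopology T (T closure_of A)) (mouth T A)))"

definition regular :: "'a topology \<Rightarrow> 'a set \<Rightarrow> bool" where
  "regular T A \<longleftrightarrow> \<not> critical T A"

definition Pi_mv :: "'a topology \<Rightarrow> 'a set set \<Rightarrow> 'a \<Rightarrow> 'a set" where
  "Pi_mv T V x = mvclass V x \<union> T closure_of {x}"

definition Pi_mv_set :: "'a topology \<Rightarrow> 'a set set \<Rightarrow> 'a set \<Rightarrow> 'a set" where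
  "Pi_mv_set T V A = (\<Union>x\<in>A. Pi_mv T V x)"

definition full_solution :: "'a topology \<Rightarrow> 'a set set \<Rightarrow> (int \<Rightarrow> 'a) \<Rightarrow> bool" where
  "full_solution T V \<phi> \<longleftrightarrow> (\<forall>i. \<phi> (i + 1) \<in> Pi_mv T V (\<phi> i))"

definition essential_solution :: "'a topology \<Rightarrow> 'a set set \<Rightarrow> (int \<Rightarrow> 'a) \<Rightarrow> bool" where
  "essential_solution T V \<phi> \<longleftrightarrow> full_solution T V \<phi> \<and>
     (\<forall>t. regular T (mvclass V (\<phi> t)) \<longrightarrow>
        (\<forall>m. \<exists>s. s < m \<and> \<phi> s \<notin> mvclass V (\<phi> t)) \<and>
        (\<forall>m. \<exists>s. s > m \<and> \<phi> s \<notin> mvclass V (\<phi> t)))"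

definition Inv :: "'a topology \<Rightarrow> 'a set set \<Rightarrow> 'a set \<Rightarrow> 'a set" where
  "Inv T V A = {x \<in> A. \<exists>\<phi>. essential_solution T V \<phi> \<and> range \<phi> \<subseteq> A \<and> \<phi> 0 = x}"

definition invariant :: "'a topology \<Rightarrow> 'a set set \<Rightarrow> 'a set \<Rightarrow> bool" where
  "invariant T V A \<longleftrightarrow> Inv T V A = A"

definition path_in :: "'a topology \<Rightarrow> 'a set set \<Rightarrow> 'a set \<Rightarrow> int \<Rightarrow> int \<Rightarrow> (int \<Rightarrow> 'a) \<Rightarrow> bool" where
  "path_in T V N a b \<phi> \<longleftrightarrow> a \<le> b \<and> \<phi> ` {a..b} \<subseteq> N \<and>
     (\<forall>i. a \<le> i \<and> i < b \<longrightarrow> \<phi> (i + 1) \<in> Pi_mv T V (\<phi> i))"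

definition isolates :: "'a topology \<Rightarrow> 'a set set \<Rightarrow> 'a set \<Rightarrow> 'a set \<Rightarrow> bool" where
  "isolates T V N S \<longleftrightarrow> closedin T N \<and> S \<subseteq> N \<and>
     (\<forall>a b \<phi>. path_in T V N a b \<phi> \<and> \<phi> a \<in> S \<and> \<phi> b \<in> S \<longrightarrow> \<phi> ` {a..b} \<subseteq> S) \<and>
     Pi_mv_set T V S \<subseteq> N"

definition isolated_invariant_set :: "'a topology \<Rightarrow> 'a set set \<Rightarrow> 'a set \<Rightarrow> bool" where
  "isolated_invariant_set T V S \<longleftrightarrow> invariant T V S \<and> (\<exists>N. isolates T V N S)"

definition index_pair :: "'a topology \<Rightarrow> 'a set set \<Rightarrow> 'a set \<Rightarrow> 'a set \<Rightarrow> 'a set \<Rightarrow> bool" where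
  "index_pair T V S P1 P2 \<longleftrightarrow> closedin T P1 \<and> closedin T P2 \<and> P2 \<subseteq> P1 \<and>
     (\<forall>x\<in>P2. \<forall>y\<in>Pi_mv T V x \<inter> P1. y \<in> P2) \<and>
     (\<forall>x\<in>P1. Pi_mv T V x - P1 \<noteq> {} \<longrightarrow> x \<in> P2) \<and>
     S = Inv T V (P1 - P2)"

end

theory Submission
  imports Defs
begin

text \<open>Each group \<open>H(P1, P2)\<close> is shown to be isomorphic to \<open>H(cl S, mo S)\<close>.

  Put \<open>L = P1 - P2\<close>, a locally closed union of multivectors. If \<open>L \<noteq> Inv L\<close>, some regular multivector
  \<open>W \<subseteq> L\<close> has no outgoing or no incoming arrow in \<open>L\<close>: otherwise every point of \<open>L\<close> could be continued
  both ways to an essential solution. Moving \<open>W\<close> into \<open>P2\<close>, respectively out of \<open>P1\<close>, changes neither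
  \<open>Inv L\<close> nor, by the exact sequence of a triple and \<open>H(cl W, mo W) = 0\<close>, the homology. Iterating, one
  reaches \<open>L = S\<close>.

  Both steps rest on the fact that \<open>H(P1, P2)\<close> depends only on \<open>P1 - P2\<close>, which is excision for closed
  covers of finite T0 spaces. The library has excision only for interiors; closed covers
  \<open>A \<union> B = X\<close> are treated by showing that \<open>C(A) + C(B) \<longrightarrow> C(X)\<close> is a quasi-isomorphism, by gluing along open
  sets and contracting minimal open neighbourhoods.\<close>

section \<open>Excision for closed covers of finite spaces\<close>

definition sum_chain :: "nat \<Rightarrow> 'a topology \<Rightarrow> 'a set \<Rightarrow> 'a set \<Rightarrow> 'a chain \<Rightarrow> bool" where
  "sum_chain p X A B c \<longleftrightarrow>
     (\<exists>a b. singular_chain p (subtopology X A) a \<and> singular_chain p (subtopology X B) b \<and> c = a + b)"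

text \<open>Acyclicity of the quotient of the singular complex by \<open>C(A) + C(B)\<close>. In degree 0 the
  condition on the boundary is void, as \<open>chain_boundary 0\<close> is the zero map.\<close>

definition excisive :: "'a topology \<Rightarrow> 'a set \<Rightarrow> 'a set \<Rightarrow> bool" where
  "excisive X A B \<longleftrightarrow>
     (\<forall>p c. singular_chain p X c \<and> sum_chain (p - Suc 0) X A B (chain_boundary p c) \<longrightarrow>
        (\<exists>d. singular_chain (Suc p) X d \<and> sum_chain p X A B (c - chain_boundary (Suc p) d)))"

text \<open>Chains are finitely supported on simplices, so a splitting can be chosen simplex by
  simplex. This turns closure properties into inclusions of \<open>keys\<close> and lets one chain
  be split compatibly with two covers at once.\<close>

lemma sum_chain_iff_keys:
  "sum_chain p X A B c \<longleftrightarrow>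
     Poly_Mapping.keys c \<subseteq> singular_simplex_set p (subtopology X A) \<union> singular_simplex_set p (subtopology X B)"
  (is "_ \<longleftrightarrow> ?rhs")
proof
  assume "sum_chain p X A B c"
  then show ?rhs
    unfolding sum_chain_def singular_chain_def
  proof (elim exE conjE)
    fix a b
    assume "Poly_Mapping.keys a \<subseteq> singular_simplex_set p (subtopology X A)"
      "Poly_Mapping.keys b \<subseteq> singular_simplex_set p (subtopology X B)" "c = a + b"
    then show ?rhs
      using keys_add [of a b] by blast
  qed
next
  assume ?rhs
  then obtain a b where "Poly_Mapping.keys a \<subseteq> singular_simplex_set p (subtopology X A)"
    "Poly_Mapping.keys b \<subseteq> singular_simplex_set p (subtopology X B)" "a + b = c"
    by (rule frag_split)
  then show "sum_chain p X A B c"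
    unfolding sum_chain_def singular_chain_def by blast
qed

lemma sum_chain_imp_chain: "sum_chain p X A B c \<Longrightarrow> singular_chain p X c"
  unfolding sum_chain_def by (elim exE conjE, simp only:, intro singular_chain_add) (simp_all add: singular_chain_subtopology)

lemma sum_chain_0 [simp]: "sum_chain p X A B 0"
  by (simp add: sum_chain_iff_keys)

lemma sum_chain_add: "\<lbrakk>sum_chain p X A B c; sum_chain p X A B d\<rbrakk> \<Longrightarrow> sum_chain p X A B (c + d)"
  unfolding sum_chain_iff_keys using keys_add [of c d] by blast

lemma sum_chain_diff: "\<lbrakk>sum_chain p X A B c; sum_chain p X A B d\<rbrakk> \<Longrightarrow> sum_chain p X A B (c - d)"
  unfolding sum_chain_iff_keys using keys_diff [of c d] by blast

lemma sum_chain_left: "singular_chain p (subtopology X A) c \<Longrightarrow> sum_chain p X A B c"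
  and sum_chain_right: "singular_chain p (subtopology X B) c \<Longrightarrow> sum_chain p X A B c"
  by (auto simp: sum_chain_iff_keys singular_chain_def)

lemma sum_chain_boundary: "sum_chain p X A B c \<Longrightarrow> sum_chain (p - Suc 0) X A B (chain_boundary p c)"
  unfolding sum_chain_def using chain_boundary_add singular_chain_boundary by blast

lemma sum_chain_subspace:
  "sum_chain p (subtopology X W) A B c \<longleftrightarrow> sum_chain p X A B c \<and> singular_chain p (subtopology X W) c"
proof -
  have "singular_simplex_set p (subtopology (subtopology X W) D)
      = singular_simplex_set p (subtopology X D) \<inter> singular_simplex_set p (subtopology X W)" for D
    by (auto simp: singular_simplex_subtopology)
  then show ?thesis
    unfolding sum_chain_iff_keys singular_chain_def by auto
qed

lemma sum_chain_restrict:
  "sum_chain p X (topspace X \<inter> A) (topspace X \<inter> B) c \<longleftrightarrow> sum_chain p X A B c"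
  by (simp add: sum_chain_def subtopology_restrict)

lemma excisive_restrict: "excisive X (topspace X \<inter> A) (topspace X \<inter> B) \<longleftrightarrow> excisive X A B"
  by (simp add: excisive_def sum_chain_restrict)

text \<open>Mayer--Vietoris for the quotient complexes \<open>C(W) / (C(A) + C(B))\<close>, carried out on chains:
  after subdivision a chain splits as \<open>u + v\<close>, and the defect of \<open>u\<close> from being a relative cycle lives
  on \<open>U \<inter> V\<close>, where it can be corrected.\<close>

lemma excisive_glue:
  assumes U: "openin X U" and V: "openin X V" and UV: "topspace X = U \<union> V"
    and excU: "excisive (subtopology X U) A B" and excV: "excisive (subtopology X V) A B"
    and excUV: "excisive (subtopology X (U \<inter> V)) A B"
  shows "excisive X A B"
  unfolding excisive_def
proof (intro allI impI, elim conjE)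
  fix p c
  assume c: "singular_chain p X c" and bc: "sum_chain (p - Suc 0) X A B (chain_boundary p c)"
  have small: "sum_chain p X U V b" if "\<And>f. f \<in> Poly_Mapping.keys b \<Longrightarrow> \<exists>W\<in>{U,V}. f \<in> standard_simplex p \<rightarrow> W"
    "singular_chain p X b" for p b
    using that unfolding sum_chain_iff_keys singular_chain_def
    by (fastforce simp: singular_simplex_subtopology)
  obtain n1 where n1: "\<And>m f. \<lbrakk>n1 \<le> m; f \<in> Poly_Mapping.keys ((singular_subdivision p ^^ m) c)\<rbrakk>
                      \<Longrightarrow> \<exists>W \<in> {U,V}. f \<in> standard_simplex p \<rightarrow> W"
    by (rule sufficient_iterated_singular_subdivision_exists [of "{U,V}" X p c]) (use U V UV c in auto)
  obtain n2 where n2: "\<And>m f. \<lbrakk>n2 \<le> m; f \<in> Poly_Mapping.keys ((singular_subdivision (p - Suc 0) ^^ m) (chain_boundary p c))\<rbrakk>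
                      \<Longrightarrow> \<exists>W \<in> {U,V}. f \<in> standard_simplex (p - Suc 0) \<rightarrow> W"
    by (rule sufficient_iterated_singular_subdivision_exists [of "{U,V}" X "p - Suc 0" "chain_boundary p c"])
      (use U V UV singular_chain_boundary [OF c] in auto)
  define m where "m = max n1 n2"
  \<comment> \<open>The chain homotopy from the identity to \<open>m\<close>-fold subdivision works
    in every space with the same \<open>h\<close>, so applied to \<open>subtopology X A\<close> and
    \<open>subtopology X B\<close> it preserves C(A) + C(B).\<close>
  obtain h where h0: "\<And>p. h p 0 = (0 :: 'a chain)"
    and hdiff: "\<And>p c1 c2. h p (c1-c2) = h p c1 - h p c2"
    and hSuc: "\<And>p X c. singular_chain p X c \<Longrightarrow> singular_chain (Suc p) X (h p c)"
    and hchain: "\<And>p X c. singular_chain p X c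
                      \<Longrightarrow> chain_boundary (Suc p) (h p c) + h (p - Suc 0) (chain_boundary p c)
                        = (singular_subdivision p ^^ m) c - c"
    using chain_homotopic_iterated_singular_subdivision [where 'a = 'a and n = m] by blast
  have hadd: "h p (c1 + c2) = h p c1 + h p c2" for p c1 c2
    by (metis add_diff_cancel diff_add_cancel hdiff)
  have hsum: "sum_chain (Suc p) X A B (h p b)" if "sum_chain p X A B b" for p b
    using that hSuc hadd unfolding sum_chain_def by blast
  define c' where "c' = (singular_subdivision p ^^ m) c"
  \<comment> \<open>Degree 0 is separate because \<open>p - Suc 0\<close> truncates:
    \<open>h\<close> would land in degree 1 there, but its argument is 0.\<close>
  have hbc: "sum_chain p X A B (h (p - Suc 0) (chain_boundary p c))"
  proof (cases p)
    case 0
    then show ?thesis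
      by (simp add: chain_boundary_def h0)
  next
    case (Suc q)
    then show ?thesis
      using hsum [OF bc] by simp
  qed
  have sc: "singular_chain p X ((singular_subdivision p ^^ k) b)" if "singular_chain p X b"
    for p k and X :: "'a topology" and b
    by (induction k) (simp_all add: that singular_chain_singular_subdivision)
  have c': "singular_chain p X c'"
    using c sc by (simp add: c'_def)
  have bsub: "chain_boundary p ((singular_subdivision p ^^ k) c)
            = (singular_subdivision (p - Suc 0) ^^ k) (chain_boundary p c)" for k
  proof (induction k)
    case (Suc k)
    then show ?case
      using chain_boundary_singular_subdivision [OF sc [OF c], of k] by simp
  qed simp
  have bc': "chain_boundary p c' = (singular_subdivision (p - Suc 0) ^^ m) (chain_boundary p c)"
    by (simp add: c'_def bsub)
  have sd_add: "(singular_subdivision q ^^ m) (a + b) =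
                (singular_subdivision q ^^ m) a + (singular_subdivision q ^^ m) b" for q and a b :: "'a chain"
    by (metis add_diff_cancel diff_add_cancel singular_subdivision_power_diff)
  have bc'M: "sum_chain (p - Suc 0) X A B (chain_boundary p c')"
  proof -
    obtain a b where "singular_chain (p - Suc 0) (subtopology X A) a"
      "singular_chain (p - Suc 0) (subtopology X B) b" "chain_boundary p c = a + b"
      using bc unfolding sum_chain_def by blast
    then show ?thesis
      unfolding bc' by (simp add: sd_add sum_chain_add sum_chain_left sum_chain_right sc)
  qed
  have bc's: "sum_chain (p - Suc 0) X U V (chain_boundary p c')"
    by (rule small) (use n2 [of m] bc' singular_chain_boundary [OF c'] in \<open>auto simp: m_def\<close>)
  have "sum_chain p X U V c'"
    by (rule small) (use n1 [of m] c' in \<open>auto simp: m_def c'_def\<close>)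
  then obtain u v where u: "singular_chain p (subtopology X U) u"
    and v: "singular_chain p (subtopology X V) v" and uv: "c' = u + v"
    by (auto simp: sum_chain_def)
  \<comment> \<open>Every simplex of this boundary lies in \<open>U\<close> or \<open>V\<close> and
    also in \<open>A\<close> or \<open>B\<close>, so both summands for the cover by \<open>U\<close>
    and \<open>V\<close> can be kept inside C(A) + C(B).\<close>
  obtain s t where s: "singular_chain (p - Suc 0) (subtopology X U) s" "sum_chain (p - Suc 0) X A B s"
    and t: "singular_chain (p - Suc 0) (subtopology X V) t" "sum_chain (p - Suc 0) X A B t"
    and st: "chain_boundary p c' = s + t"
  proof -
    let ?S = "\<lambda>D. singular_simplex_set (p - Suc 0) (subtopology X D)"
    have "Poly_Mapping.keys (chain_boundary p c') \<subseteq> ?S U \<inter> (?S A \<union> ?S B) \<union> ?S V \<inter> (?S A \<union> ?S B)"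
      using bc'M bc's unfolding sum_chain_iff_keys by blast
    then obtain s t where "Poly_Mapping.keys s \<subseteq> ?S U \<inter> (?S A \<union> ?S B)"
      "Poly_Mapping.keys t \<subseteq> ?S V \<inter> (?S A \<union> ?S B)" "s + t = chain_boundary p c'"
      by (rule frag_split)
    then show thesis
      using that [of s t] unfolding sum_chain_iff_keys singular_chain_def by simp
  qed
  \<comment> \<open>The defect of \<open>u\<close>. Rewritten through \<open>v\<close> in
    \<open>w2\<close>, it is seen to live on \<open>V\<close> as well as on
    \<open>U\<close>.\<close>
  define w where "w = chain_boundary p u - s"
  have w2: "w = t - chain_boundary p v"
    using st by (simp add: w_def uv chain_boundary_add algebra_simps)
  have wU: "singular_chain (p - Suc 0) (subtopology X U) w"
    unfolding w_def by (intro singular_chain_diff singular_chain_boundary u s)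
  moreover have wV: "singular_chain (p - Suc 0) (subtopology X V) w"
    unfolding w2 by (intro singular_chain_diff singular_chain_boundary v t)
  ultimately have wUV: "singular_chain (p - Suc 0) (subtopology X (U \<inter> V)) w"
    by (simp add: singular_chain_subtopology)
  \<comment> \<open>In degree 0 the boundary of \<open>u\<close> vanishes, so \<open>w\<close> is
    \<open>- s\<close> and nothing has to be corrected. Otherwise the boundary of \<open>w\<close>
    is minus that of \<open>s\<close>, so \<open>w\<close> is a relative cycle on the intersection
    and \<open>excUV\<close> applies.\<close>
  obtain d where d: "singular_chain p (subtopology X (U \<inter> V)) d"
    and dM: "sum_chain (p - Suc 0) (subtopology X (U \<inter> V)) A B (w - chain_boundary p d)"
  proof (cases p)
    case 0
    have "sum_chain (p - Suc 0) (subtopology X (U \<inter> V)) A B w"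
      unfolding sum_chain_subspace using s 0 wUV
      by (auto simp: w_def chain_boundary_def sum_chain_iff_keys)
    then show thesis
      using that [of 0] by simp
  next
    case (Suc q)
    have "chain_boundary q (chain_boundary p u) = 0"
      using chain_boundary_boundary [OF u] Suc by simp
    then have "chain_boundary q w = 0 - chain_boundary q s"
      by (simp add: w_def chain_boundary_diff)
    moreover have "sum_chain (q - Suc 0) X A B (0 - chain_boundary q s)"
      using s Suc by (intro sum_chain_diff sum_chain_boundary) auto
    moreover have "singular_chain (q - Suc 0) (subtopology X (U \<inter> V)) (chain_boundary q w)"
      using wUV Suc by (simp add: singular_chain_boundary)
    ultimately have "sum_chain (q - Suc 0) (subtopology X (U \<inter> V)) A B (chain_boundary q w)"
      by (simp add: sum_chain_subspace)
    then show thesis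
      using excUV wUV that Suc unfolding excisive_def by auto
  qed
  have dU: "singular_chain p (subtopology X U) d" and dV: "singular_chain p (subtopology X V) d"
    using d singular_chain_mono by blast+
  have dMX: "sum_chain (p - Suc 0) X A B (w - chain_boundary p d)"
    using dM by (simp add: sum_chain_subspace)
  \<comment> \<open>After subtracting \<open>d\<close> from \<open>u\<close> and adding it to
    \<open>v\<close>, both pieces are relative cycles, while their sum is still
    \<open>c'\<close>.\<close>
  obtain e where e: "singular_chain (Suc p) (subtopology X U) e"
    and eM: "sum_chain p (subtopology X U) A B ((u - d) - chain_boundary (Suc p) e)"
  proof -
    have "chain_boundary p (u - d) = s + (w - chain_boundary p d)"
      by (simp add: w_def chain_boundary_diff)
    then have "sum_chain (p - Suc 0) X A B (chain_boundary p (u - d))"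
      using s dMX sum_chain_add by metis
    moreover have "singular_chain p (subtopology X U) (u - d)"
      by (simp add: u dU singular_chain_diff)
    ultimately show thesis
      using excU that unfolding excisive_def by (metis singular_chain_boundary sum_chain_subspace)
  qed
  obtain e' where e': "singular_chain (Suc p) (subtopology X V) e'"
    and e'M: "sum_chain p (subtopology X V) A B ((v + d) - chain_boundary (Suc p) e')"
  proof -
    have "chain_boundary p (v + d) = t - (w - chain_boundary p d)"
      by (simp add: w2 chain_boundary_add)
    then have "sum_chain (p - Suc 0) X A B (chain_boundary p (v + d))"
      using t dMX sum_chain_diff by metis
    moreover have "singular_chain p (subtopology X V) (v + d)"
      by (simp add: v dV singular_chain_add)
    ultimately show thesis
      using excV that unfolding excisive_def by (metis singular_chain_boundary sum_chain_subspace)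
  qed
  \<comment> \<open>The term \<open>- h p c\<close> carries \<open>c\<close> to its subdivision
    \<open>c'\<close>; the remaining term, \<open>h\<close> of the boundary, is harmless by
    \<open>hbc\<close>.\<close>
  define D where "D = e + e' - h p c"
  have "singular_chain (Suc p) X D"
    using e e' hSuc [OF c] unfolding D_def
    by (intro singular_chain_diff singular_chain_add) (auto simp: singular_chain_subtopology)
  moreover have "c - chain_boundary (Suc p) D =
       ((u - d) - chain_boundary (Suc p) e) + ((v + d) - chain_boundary (Suc p) e')
       - h (p - Suc 0) (chain_boundary p c)"
    using hchain [OF c] uv unfolding D_def c'_def [symmetric]
    by (simp add: chain_boundary_add chain_boundary_diff algebra_simps)
  moreover have "sum_chain p X A B \<dots>"
    by (rule sum_chain_diff [OF sum_chain_add hbc]) (use eM e'M in \<open>simp_all only: sum_chain_subspace\<close>)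
  ultimately show "\<exists>d. singular_chain (Suc p) X d \<and> sum_chain p X A B (c - chain_boundary (Suc p) d)"
    by metis
qed

section \<open>Contractions to a point whose only open neighbourhood is the whole space\<close>

lemma t0_space_closed_point:
  assumes "finite (topspace X)" "t0_space X" "topspace X \<noteq> {}"
  obtains y where "y \<in> topspace X" "closedin X {y}"
proof -
  \<comment> \<open>A nonempty closed set of least cardinality is a singleton: an open set
    separating two of its points would cut out a smaller nonempty closed set.\<close>
  obtain C where C: "closedin X C" "C \<noteq> {}"
    and min: "\<And>D. closedin X D \<and> D \<noteq> {} \<Longrightarrow> card C \<le> card D"
    using ex_has_least_nat [of "\<lambda>C. closedin X C \<and> C \<noteq> {}" "topspace X" card] assms(3) by auto
  obtain y where y: "y \<in> C"
    using C by blast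
  have CX: "C \<subseteq> topspace X"
    using C closedin_subset by blast
  have "x = y" if x: "x \<in> C" for x
  proof (rule ccontr)
    assume "x \<noteq> y"
    moreover have "x \<in> topspace X" "y \<in> topspace X"
      using x y CX by auto
    ultimately have "\<exists>U. openin X U \<and> (x \<notin> U \<longleftrightarrow> y \<in> U)"
      using assms(2) by (simp add: t0_space_def)
    then obtain U where U: "openin X U" "x \<notin> U \<longleftrightarrow> y \<in> U"
      by (elim exE conjE)
    have "closedin X (C - U)"
      using C(1) U(1) by (simp add: closedin_diff)
    moreover have "C - U \<noteq> {}" "C - U \<subset> C"
      using U(2) x y by auto
    ultimately show False
      using min [of "C - U"] psubset_card_mono [of C "C - U"] finite_subset [OF CX assms(1)] by auto
  qed
  then have "C = {y}"
    using y by blast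
  then show thesis
    using that C CX by auto
qed

text \<open>The homotopy is the identity until time 1 and then jumps to \<open>y\<close>. It is
  continuous because the preimage of an open \<open>U\<close> is everything when \<open>y\<close> is
  in \<open>U\<close>, and [0,1) times \<open>U\<close> otherwise.\<close>

lemma homotopic_with_const_cone_point:
  assumes y: "y \<in> topspace X" and cone: "\<And>U. \<lbrakk>openin X U; y \<in> U\<rbrakk> \<Longrightarrow> U = topspace X" and "y \<in> S"
  shows "homotopic_with (\<lambda>h. h \<in> S \<rightarrow> S) X X id (\<lambda>x. y)"
proof -
  define h where "h = (\<lambda>(t::real, x). if t = 1 then y else x)"
  have "continuous_map (prod_topology (top_of_set {0..1}) X) X h"
    unfolding continuous_map_def
  proof (intro conjI allI impI)
    show "h \<in> topspace (prod_topology (top_of_set {0..1}) X) \<rightarrow> topspace X"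
      using y by (auto simp: h_def)
    fix U
    assume U: "openin X U"
    show "openin (prod_topology (top_of_set {0..1}) X)
            {z \<in> topspace (prod_topology (top_of_set {0..1}) X). h z \<in> U}"
    proof (cases "y \<in> U")
      case True
      then have "{z \<in> topspace (prod_topology (top_of_set {0..1}) X). h z \<in> U}
               = topspace (prod_topology (top_of_set {0..1}) X)"
        using cone [OF U] y by (auto simp: h_def)
      then show ?thesis
        by (metis openin_topspace)
    next
      case False
      then have "{z \<in> topspace (prod_topology (top_of_set {0..1}) X). h z \<in> U} = {0..<1} \<times> U"
        using openin_subset [OF U] by (auto simp: h_def split: if_splits)
      moreover have "openin (top_of_set {0..1::real}) {0..<1}"
      proof -
        have "{0..<1::real} = {0..1} \<inter> {..<1}"
          by auto
        then show ?thesis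
          by (metis open_lessThan openin_open_Int)
      qed
      ultimately show ?thesis
        using U by (simp add: openin_prod_Times_iff)
    qed
  qed
  then show ?thesis
    using \<open>y \<in> S\<close> unfolding homotopic_with_def by (intro exI [of _ h]) (auto simp: h_def)
qed

text \<open>The contraction preserves \<open>S\<close>, so a relative cycle is homologous to its
  image under the constant map, which lies in \<open>S\<close>. Hence the pair (\<open>X\<close>,
  \<open>S\<close>) has no homology.\<close>

lemma relcycle_cone_point:
  assumes y: "y \<in> topspace X" and cone: "\<And>U. \<lbrakk>openin X U; y \<in> U\<rbrakk> \<Longrightarrow> U = topspace X" and "y \<in> S"
    and c: "singular_relcycle p X S c"
  obtains d where "singular_chain (Suc p) X d"
    "singular_chain p (subtopology X S) (c - chain_boundary (Suc p) d)"
proof -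
  have "homologous_rel p X S (chain_map p id c) (chain_map p (\<lambda>x. y) c)"
    by (rule homotopic_imp_homologous_rel_chain_maps
        [OF homotopic_with_const_cone_point [OF y cone \<open>y \<in> S\<close>] c])
  moreover have cX: "singular_chain p X c"
    using c by (simp add: singular_relcycle_def)
  ultimately obtain d e where "singular_chain (Suc p) X d" and e: "singular_chain p (subtopology X S) e"
    and de: "chain_boundary (Suc p) d = (c - chain_map p (\<lambda>x. y) c) + e"
    unfolding homologous_rel_def singular_relboundary_alt by (auto simp: chain_map_ident [OF cX])
  moreover have "continuous_map X (subtopology X S) (\<lambda>x. y)"
    using y \<open>y \<in> S\<close> by simp
  then have "singular_chain p (subtopology X S) (chain_map p (\<lambda>x. y) c)"
    using cX singular_chain_chain_map by blast
  then have "singular_chain p (subtopology X S) (chain_map p (\<lambda>x. y) c - e)"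
    using e by (rule singular_chain_diff)
  moreover have "c - chain_boundary (Suc p) d = chain_map p (\<lambda>x. y) c - e"
    using de by simp
  ultimately show thesis
    using that by metis
qed

text \<open>All of \<open>A\<close>, \<open>B\<close>, \<open>X\<close> and the intersection of
  \<open>A\<close> and \<open>B\<close> contain \<open>y\<close>, so the first three have no
  homology relative to the last. Contracting in \<open>A\<close> and \<open>B\<close> moves the
  boundary of \<open>c\<close> into the intersection; contracting in \<open>X\<close> then moves the
  chain itself there.\<close>

lemma excisive_cone_point:
  assumes y: "y \<in> topspace X" and cone: "\<And>U. \<lbrakk>openin X U; y \<in> U\<rbrakk> \<Longrightarrow> U = topspace X"
    and A: "y \<in> A" and B: "y \<in> B"
  shows "excisive X A B"
  unfolding excisive_def
proof (intro allI impI, elim conjE)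
  fix p c
  assume c: "singular_chain p X c" and bc: "sum_chain (p - Suc 0) X A B (chain_boundary p c)"
  \<comment> \<open>Used for \<open>D\<close> equal to \<open>A\<close>, \<open>B\<close> and
    \<open>UNIV\<close>.\<close>
  have sub: "\<exists>g. singular_chain (Suc q) (subtopology X D) g
        \<and> singular_chain q (subtopology X (A \<inter> B)) (a - chain_boundary (Suc q) g)"
    if "y \<in> D" "A \<inter> B \<subseteq> D" and a: "singular_chain q (subtopology X D) a"
      "singular_chain (q - Suc 0) (subtopology X (A \<inter> B)) (chain_boundary q a)" for D q a
  proof -
    have D: "D \<inter> (A \<inter> B) = A \<inter> B"
      using that by blast
    have "singular_relcycle q (subtopology X D) (A \<inter> B) a"
      using a by (simp add: singular_relcycle subtopology_subtopology D)
    moreover have "y \<in> topspace (subtopology X D)"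
      using y that by simp
    moreover have "W = topspace (subtopology X D)" if "openin (subtopology X D) W" "y \<in> W" for W
      using that cone by (force simp: openin_subtopology)
    moreover have "y \<in> A \<inter> B"
      using A B by simp
    ultimately show ?thesis
      using relcycle_cone_point [of y "subtopology X D" "A \<inter> B" q a]
      by (metis D subtopology_subtopology)
  qed
  have X: "singular_chain q (subtopology X UNIV) = singular_chain q X" for q
    by (simp add: subtopology_UNIV)
  have "\<exists>g. sum_chain p X A B g \<and> singular_chain (p - Suc 0) (subtopology X (A \<inter> B)) (chain_boundary p (c - g))"
  proof (cases p)
    case 0
    then show ?thesis
      by (intro exI [of _ 0]) (simp add: chain_boundary_def)
  next
    case (Suc q)
    obtain a b where a: "singular_chain q (subtopology X A) a" and b: "singular_chain q (subtopology X B) b"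
      and ab: "chain_boundary p c = a + b"
      using bc Suc unfolding sum_chain_def by auto
    have "chain_boundary q (a + b) = 0"
      using chain_boundary_boundary [OF c] Suc by (simp flip: ab)
    \<comment> \<open>Being equal up to sign, the boundaries of \<open>a\<close> and
      \<open>b\<close> lie in both \<open>A\<close> and \<open>B\<close>.\<close>
    then have bab: "chain_boundary q a = - chain_boundary q b"
      by (simp add: chain_boundary_add eq_neg_iff_add_eq_0)
    have ba: "singular_chain (q - Suc 0) (subtopology X A) (chain_boundary q a)"
      and bb: "singular_chain (q - Suc 0) (subtopology X B) (chain_boundary q b)"
      using a b by (simp_all add: singular_chain_boundary)
    have baAB: "singular_chain (q - Suc 0) (subtopology X (A \<inter> B)) (chain_boundary q a)"
      using ba bb bab by (auto simp: singular_chain_subtopology)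
    then have bbAB: "singular_chain (q - Suc 0) (subtopology X (A \<inter> B)) (chain_boundary q b)"
      by (simp add: bab singular_chain_minus)
    obtain g where g: "singular_chain p (subtopology X A) g"
      "singular_chain q (subtopology X (A \<inter> B)) (a - chain_boundary p g)"
      using sub [OF A _ a baAB] Suc by auto
    obtain g' where g': "singular_chain p (subtopology X B) g'"
      "singular_chain q (subtopology X (A \<inter> B)) (b - chain_boundary p g')"
      using sub [OF B _ b bbAB] Suc by auto
    have "chain_boundary p (c - (g + g')) = (a - chain_boundary p g) + (b - chain_boundary p g')"
      by (simp add: ab chain_boundary_diff chain_boundary_add)
    then have "singular_chain (p - Suc 0) (subtopology X (A \<inter> B)) (chain_boundary p (c - (g + g')))"
      using singular_chain_add [OF g(2) g'(2)] Suc by simp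
    then show ?thesis
      using sum_chain_add [OF sum_chain_left [OF g(1)] sum_chain_right [OF g'(1)]] by blast
  qed
  then obtain g where g: "sum_chain p X A B g"
    and bg: "singular_chain (p - Suc 0) (subtopology X (A \<inter> B)) (chain_boundary p (c - g))"
    by blast
  have "singular_chain p X (c - g)"
    using c g sum_chain_imp_chain singular_chain_diff by blast
  then obtain d where d: "singular_chain (Suc p) X d"
    "singular_chain p (subtopology X (A \<inter> B)) (c - g - chain_boundary (Suc p) d)"
    using sub [of UNIV p "c - g"] bg by (auto simp: X)
  have "sum_chain p X A B (c - g - chain_boundary (Suc p) d)"
    using d(2) singular_chain_mono by (blast intro: sum_chain_left)
  from sum_chain_add [OF this g]
  have "sum_chain p X A B (c - chain_boundary (Suc p) d)"
    by simp
  then show "\<exists>d. singular_chain (Suc p) X d \<and> sum_chain p X A B (c - chain_boundary (Suc p) d)"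
    using d(1) by blast
qed

lemma excisive_trivial:
  assumes "topspace X \<subseteq> A \<or> topspace X \<subseteq> B"
  shows "excisive X A B"
proof -
  have "subtopology X A = X \<or> subtopology X B = X"
    using assms by (metis inf.absorb_iff1 subtopology_restrict subtopology_topspace)
  then have "sum_chain p X A B c" if "singular_chain p X c" for p c
    using that sum_chain_left [of p X A c B] sum_chain_right [of p X B c A] by auto
  then show ?thesis
    unfolding excisive_def by (metis chain_boundary_0 diff_zero singular_chain_0)
qed

text \<open>Peel off a closed point \<open>y\<close>: glue its minimal open neighbourhood \<open>U\<close> to \<open>topspace X - {y}\<close>. If \<open>U\<close>
  is everything, then a closed set missing \<open>y\<close> is empty, so either \<open>y\<close> lies in both closed sets or one
  of them is the whole space.\<close>

lemma excisive_finite_closed: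
  assumes "finite (topspace X)" "t0_space X" "closedin X A" "closedin X B" "A \<union> B = topspace X"
  shows "excisive X A B"
  using assms
proof (induction "card (topspace X)" arbitrary: X A B rule: less_induct)
  case less
  have sub: "excisive (subtopology X W) A B" if W: "W \<subset> topspace X" for W
  proof -
    have "excisive (subtopology X W) (W \<inter> A) (W \<inter> B)"
    proof (rule less.hyps)
      show "card (topspace (subtopology X W)) < card (topspace X)"
        using W less.prems(1) by (metis inf.absorb_iff2 psubset_card_mono psubset_eq topspace_subtopology)
      show "finite (topspace (subtopology X W))"
        using less.prems(1) by simp
      show "t0_space (subtopology X W)"
        using less.prems(2) by (rule t0_space_subtopology)
      show "closedin (subtopology X W) (W \<inter> A)" "closedin (subtopology X W) (W \<inter> B)"
        using less.prems(3,4) closedin_subtopology by blast+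
      show "W \<inter> A \<union> W \<inter> B = topspace (subtopology X W)"
        using W less.prems(5) by auto
    qed
    moreover have "topspace (subtopology X W) = W"
      using W by auto
    ultimately show ?thesis
      using excisive_restrict by metis
  qed
  show ?case
  proof (cases "topspace X = {}")
    case True
    then show ?thesis
      by (simp add: excisive_trivial)
  next
    case False
    then obtain y where y: "y \<in> topspace X" "closedin X {y}"
      using t0_space_closed_point less.prems by metis
    define U where "U = \<Inter>{W. openin X W \<and> y \<in> W}"
    have "finite {W. openin X W \<and> y \<in> W}"
      using less.prems(1) openin_subset by (metis (no_types, lifting) finite_Pow_iff finite_subset mem_Collect_eq Pow_iff subsetI)
    then have U: "openin X U"
      unfolding U_def using y(1) by (intro openin_Inter) auto
    have yU: "y \<in> U" and Umin: "\<And>W. \<lbrakk>openin X W; y \<in> W\<rbrakk> \<Longrightarrow> U \<subseteq> W"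
      by (auto simp: U_def)
    have UX: "U \<subseteq> topspace X"
      using U openin_subset by blast
    show ?thesis
    proof (cases "U = topspace X")
      case True
      have cone: "W = topspace X" if "openin X W" "y \<in> W" for W
        using Umin [OF that] True openin_subset [OF that(1)] by blast
      have "topspace X \<subseteq> D" if "closedin X D" "y \<notin> E" "D \<union> E = topspace X" "closedin X E" for D E
        using cone [of "topspace X - E"] that y by auto
      then show ?thesis
        using excisive_cone_point [OF y(1) cone] excisive_trivial less.prems(3-5)
        by (metis sup_commute)
    next
      case False
      let ?V = "topspace X - {y}"
      have "openin X ?V"
        using y by blast
      moreover have "topspace X = U \<union> ?V"
        using UX yU by blast
      moreover have "?V \<subset> topspace X" "U \<subset> topspace X" "U \<inter> ?V \<subset> topspace X"
        using y UX False by auto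
      ultimately show ?thesis
        using excisive_glue [OF U] sub by metis
    qed
  qed
qed

section \<open>From acyclicity on chains to isomorphisms of relative homology\<close>

lemma excisive_relboundary:
  assumes exc: "excisive X A B" and c: "singular_chain n (subtopology X A) c"
    and rb: "singular_relboundary n X B c"
  shows "singular_relboundary n (subtopology X A) (A \<inter> B) c"
proof -
  obtain d e where d: "singular_chain (Suc n) X d" and e: "singular_chain n (subtopology X B) e"
    and de: "chain_boundary (Suc n) d = c + e"
    using rb unfolding singular_relboundary_alt by blast
  \<comment> \<open>Acyclicity replaces the bounding chain \<open>d\<close> by \<open>a + b\<close>.
    Comparing boundaries, \<open>a\<close> bounds \<open>c\<close> up to a chain lying in both
    \<open>A\<close> and \<open>B\<close>; this is injectivity.\<close>
  have "sum_chain n X A B (chain_boundary (Suc n) d)"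
    using c e de unfolding sum_chain_def by blast
  then obtain d' a b where d': "singular_chain (Suc (Suc n)) X d'"
    and a: "singular_chain (Suc n) (subtopology X A) a"
    and b: "singular_chain (Suc n) (subtopology X B) b"
    and ab: "d - chain_boundary (Suc (Suc n)) d' = a + b"
    using exc [unfolded excisive_def, rule_format, of "Suc n" d] d by (auto simp: sum_chain_def [of "Suc n"])
  have "chain_boundary (Suc n) (a + b) = c + e"
    using chain_boundary_boundary_alt [OF d'] by (simp add: chain_boundary_diff de flip: ab)
  then have eq: "chain_boundary (Suc n) a - c = e - chain_boundary (Suc n) b"
    by (simp add: chain_boundary_add algebra_simps)
  have "singular_chain n (subtopology X A) (chain_boundary (Suc n) a - c)"
    using a c by (simp add: singular_chain_boundary_alt singular_chain_diff)
  moreover have "singular_chain n (subtopology X B) (chain_boundary (Suc n) a - c)"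
    unfolding eq using b e by (simp add: singular_chain_boundary_alt singular_chain_diff)
  ultimately have "singular_chain n (subtopology (subtopology X A) (A \<inter> B)) (chain_boundary (Suc n) a - c)"
    by (auto simp: singular_chain_subtopology)
  then show ?thesis
    unfolding singular_relboundary_alt using a by (intro exI conjI) auto
qed

text \<open>Surjectivity: modulo a boundary, \<open>c\<close> is \<open>a + b\<close>. Dropping
  \<open>b\<close> does not change the class relative to \<open>B\<close>, and the boundary of
  \<open>a\<close> lies in \<open>B\<close> because those of \<open>c\<close> and \<open>b\<close>
  do.\<close>

lemma excisive_relcycle:
  assumes exc: "excisive X A B" and c: "singular_relcycle n X B c"
  obtains a where "singular_relcycle n (subtopology X A) (A \<inter> B) a" "homologous_rel n X B c a"
proof -
  have cX: "singular_chain n X c" and bc: "singular_chain (n - Suc 0) (subtopology X B) (chain_boundary n c)"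
    using c by (auto simp: singular_relcycle)
  then obtain d a b where d: "singular_chain (Suc n) X d"
    and a: "singular_chain n (subtopology X A) a"
    and b: "singular_chain n (subtopology X B) b"
    and ab: "c - chain_boundary (Suc n) d = a + b"
    using exc sum_chain_right unfolding excisive_def sum_chain_def by metis
  have "chain_boundary n a = chain_boundary n (a + b) - chain_boundary n b"
    by (simp add: chain_boundary_add)
  also have "\<dots> = chain_boundary n c - chain_boundary n b"
    using chain_boundary_boundary_alt [OF d] by (simp add: chain_boundary_diff flip: ab)
  finally have "singular_chain (n - Suc 0) (subtopology X B) (chain_boundary n a)"
    using bc b by (simp add: singular_chain_boundary singular_chain_diff)
  then have "singular_chain (n - Suc 0) (subtopology (subtopology X A) (A \<inter> B)) (chain_boundary n a)"
    using singular_chain_boundary [OF a] by (auto simp: singular_chain_subtopology)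
  then have "singular_relcycle n (subtopology X A) (A \<inter> B) a"
    using a by (simp add: singular_relcycle)
  moreover have "chain_boundary (Suc n) d = (c - a) + (- b)"
    using ab by (simp add: algebra_simps)
  then have "homologous_rel n X B c a"
    unfolding homologous_rel_def singular_relboundary_alt using d b singular_chain_minus by blast
  ultimately show thesis
    by (rule that)
qed

lemma excisive_imp_iso:
  assumes exc: "excisive X A B"
  shows "hom_induced p (subtopology X A) (A \<inter> B) X B id
    \<in> iso (relative_homology_group p (subtopology X A) (A \<inter> B)) (relative_homology_group p X B)"
proof (cases "p < 0")
  case True
  then show ?thesis
    unfolding iso_def bij_betw_def relative_homology_group_def by (simp add: hom_induced_trivial)
next
  case False
  then obtain n where peq: "p = int n"
    by (metis int_nat_eq not_le)
  let ?Y = "subtopology X A" and ?S = "A \<inter> B"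
  have cont: "continuous_map ?Y X id" and im: "id \<in> topspace ?Y \<inter> ?S \<rightarrow> B"
    by (auto simp: continuous_map_from_subtopology)
  have hom: "hom_induced n ?Y ?S X B id (homologous_rel_set n ?Y ?S c) = homologous_rel_set n X B c"
    if "singular_relcycle n ?Y ?S c" for c
  proof -
    have "singular_chain n X c"
      using that by (simp add: singular_relcycle singular_chain_subtopology)
    then show ?thesis
      using hom_induced_chain_map_gen [OF cont im that] by (simp add: chain_map_ident)
  qed
  have cyc: "singular_relcycle n X B c" if "singular_relcycle n ?Y ?S c" for c
    using that singular_chain_mono
    by (fastforce simp: singular_relcycle singular_chain_subtopology)
  show ?thesis
    unfolding iso_def bij_betw_def peq mem_Collect_eq carrier_relative_homology_group
  proof (intro conjI)
    show "inj_on (hom_induced n ?Y ?S X B id) (homologous_rel_set n ?Y ?S ` singular_relcycle_set n ?Y ?S)"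
    proof (clarsimp simp: inj_on_def hom)
      fix c d
      assume c: "singular_relcycle n ?Y ?S c" and d: "singular_relcycle n ?Y ?S d"
        and "homologous_rel_set n X B c = homologous_rel_set n X B d"
      then have "homologous_rel n X B c d"
        by (simp only: homologous_rel_set_eq)
      then have "singular_relboundary n X B (c - d)"
        by (simp only: homologous_rel_def)
      moreover have "singular_chain n ?Y (c - d)"
        using c d by (simp add: singular_relcycle singular_chain_diff)
      ultimately have "homologous_rel n ?Y ?S c d"
        unfolding homologous_rel_def using excisive_relboundary [OF exc] by blast
      then show "homologous_rel_set n ?Y ?S c = homologous_rel_set n ?Y ?S d"
        by (simp only: homologous_rel_set_eq)
    qed
    show "hom_induced n ?Y ?S X B id ` homologous_rel_set n ?Y ?S ` singular_relcycle_set n ?Y ?S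
        = homologous_rel_set n X B ` singular_relcycle_set n X B" (is "?l = ?r")
    proof
      show "?l \<subseteq> ?r"
        using hom cyc by auto
      show "?r \<subseteq> ?l"
      proof clarify
        fix c
        assume "singular_relcycle n X B c"
        then obtain a where a: "singular_relcycle n ?Y ?S a" "homologous_rel n X B c a"
          using excisive_relcycle [OF exc] by blast
        then have "homologous_rel_set n X B c = hom_induced n ?Y ?S X B id (homologous_rel_set n ?Y ?S a)"
          by (simp only: hom homologous_rel_set_eq)
        then show "homologous_rel_set n X B c \<in> ?l"
          using a by blast
      qed
    qed
  qed (rule hom_induced_hom)
qed

text \<open>Inside \<open>P\<close>, the closure of \<open>P - Q\<close> and \<open>Q\<close> form a
  closed cover whose intersection is exactly the mouth of \<open>P - Q\<close>, so closed excision
  applies.\<close>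

lemma homology_locally_closed:
  assumes "finite (topspace T)" "t0_space T" "closedin T P" "closedin T Q" "Q \<subseteq> P"
  shows "relative_homology_group p (subtopology T (T closure_of (P - Q))) (mouth T (P - Q))
       \<cong> relative_homology_group p (subtopology T P) Q"
proof -
  let ?K = "T closure_of (P - Q)"
  have KP: "?K \<subseteq> P"
    using assms(3) by (simp add: closure_of_minimal)
  have PT: "P \<subseteq> topspace T"
    using assms(3) closedin_subset by blast
  then have LK: "P - Q \<subseteq> ?K"
    by (intro closure_of_subset) auto
  have "excisive (subtopology T P) ?K Q"
  proof (rule excisive_finite_closed)
    show "t0_space (subtopology T P)"
      using assms(2) by (rule t0_space_subtopology)
    show "closedin (subtopology T P) ?K" "closedin (subtopology T P) Q"
      using KP assms by (simp_all add: closedin_closed_subtopology)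
    show "?K \<union> Q = topspace (subtopology T P)"
      using KP LK PT assms(5) by auto
  qed (use assms(1) in simp)
  from excisive_imp_iso [OF this, of p]
  have "relative_homology_group p (subtopology (subtopology T P) ?K) (?K \<inter> Q)
       \<cong> relative_homology_group p (subtopology T P) Q"
    by (rule is_isoI)
  moreover have "subtopology (subtopology T P) ?K = subtopology T ?K"
    using KP by (simp add: subtopology_subtopology inf.absorb2)
  moreover have "?K \<inter> Q = mouth T (P - Q)"
    using KP by (auto simp: mouth_def)
  ultimately show ?thesis
    by simp
qed

text \<open>In the exact sequence of the triple, the wanted map sits between H_{p+1}(X,A) and
  H_p(X,A), both zero.\<close>

lemma iso_homology_triple_trivial_upper:
  assumes "B \<subseteq> A" and triv: "\<And>p. trivial_group (relative_homology_group p X A)"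
  shows "relative_homology_group p (subtopology X A) B \<cong> relative_homology_group p X B"
proof -
  have "exact_seq ([relative_homology_group p X A, relative_homology_group p X B,
                    relative_homology_group p (subtopology X A) B, relative_homology_group (p + 1) X A],
                   [hom_induced p X B X A id, hom_induced p (subtopology X A) B X B id,
                    hom_relboundary (p + 1) X A B])"
    using homology_exactness_triple_3 [OF assms(1), of p X] homology_exactness_triple_2 [OF assms(1), of "p + 1" X]
    by simp
  then show ?thesis
    using very_short_exact_sequence triv by (metis is_isoI)
qed

text \<open>Here the neighbours are H_p(A,B) and H_{p-1}(A,B).\<close>

lemma iso_homology_triple_trivial_lower:
  assumes "B \<subseteq> A" and triv: "\<And>p. trivial_group (relative_homology_group p (subtopology X A) B)"
  shows "relative_homology_group p X B \<cong> relative_homology_group p X A"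
proof -
  have "exact_seq ([relative_homology_group (p - 1) (subtopology X A) B, relative_homology_group p X A,
                    relative_homology_group p X B, relative_homology_group p (subtopology X A) B],
                   [hom_relboundary p X A B, hom_induced p X B X A id,
                    hom_induced p (subtopology X A) B X B id])"
    using homology_exactness_triple_3 [OF assms(1), of p X] homology_exactness_triple_1 [OF assms(1), of p X]
    by simp
  then show ?thesis
    using very_short_exact_sequence triv by (metis is_isoI)
qed

section \<open>Removing regular multivectors\<close>

lemma multivector_field_mvclass:
  assumes "multivector_field T V"
  shows mvclass_eq: "\<lbrakk>A \<in> V; x \<in> A\<rbrakk> \<Longrightarrow> mvclass V x = A"
    and mvclass_in: "x \<in> topspace T \<Longrightarrow> mvclass V x \<in> V"
    and in_mvclass: "x \<in> topspace T \<Longrightarrow> x \<in> mvclass V x"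
proof -
  show eq: "mvclass V x = A" if "A \<in> V" "x \<in> A" for A x
    unfolding mvclass_def
  proof (rule the_equality)
    show "B = A" if "B \<in> V \<and> x \<in> B" for B
      using assms that \<open>A \<in> V\<close> \<open>x \<in> A\<close> unfolding multivector_field_def by blast
  qed (use that in blast)
  show "mvclass V x \<in> V" "x \<in> mvclass V x" if "x \<in> topspace T"
  proof -
    have "x \<in> \<Union>V"
      using assms that by (simp add: multivector_field_def)
    then obtain A where A: "A \<in> V" "x \<in> A"
      by blast
    then show "mvclass V x \<in> V" "x \<in> mvclass V x"
      by (simp_all add: eq [OF A])
  qed
qed

text \<open>Iterating \<open>f\<close> forwards and \<open>g\<close> backwards from \<open>x\<close>
  gives a full solution; \<open>ff\<close> and \<open>gg\<close> make it leave any regular class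
  within two steps in either direction.\<close>

lemma subset_Inv:
  assumes f: "\<And>x. x \<in> L \<Longrightarrow> f x \<in> L \<and> f x \<in> Pi_mv T V x"
    and g: "\<And>x. x \<in> L \<Longrightarrow> g x \<in> L \<and> x \<in> Pi_mv T V (g x)"
    and ff: "\<And>x. \<lbrakk>x \<in> L; regular T (mvclass V x)\<rbrakk> \<Longrightarrow> f x \<notin> mvclass V x \<or> f (f x) \<notin> mvclass V x"
    and gg: "\<And>x. \<lbrakk>x \<in> L; regular T (mvclass V x)\<rbrakk> \<Longrightarrow> g x \<notin> mvclass V x \<or> g (g x) \<notin> mvclass V x"
    and same: "\<And>x y. \<lbrakk>x \<in> L; y \<in> L; y \<in> mvclass V x\<rbrakk> \<Longrightarrow> mvclass V y = mvclass V x"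
  shows "L \<subseteq> Inv T V L"
proof
  fix x
  assume x: "x \<in> L"
  define \<phi> where "\<phi> n = (if n \<ge> 0 then (f ^^ nat n) x else (g ^^ nat (- n)) x)" for n :: int
  have "(f ^^ n) x \<in> L" "(g ^^ n) x \<in> L" for n
    by (induction n) (use x f g in auto)
  then have L: "\<phi> n \<in> L" for n
    by (simp add: \<phi>_def)
  have fstep: "\<phi> (n + 1) = f (\<phi> n)" if "n \<ge> 0" for n
    using that by (simp add: \<phi>_def nat_add_distrib)
  have gstep: "\<phi> (n - 1) = g (\<phi> n)" if "n \<le> 0" for n
  proof -
    have "nat (- (n - 1)) = Suc (nat (- n))"
      using that by simp
    then have "\<phi> (n - 1) = g ((g ^^ nat (- n)) x)"
      using that by (simp add: \<phi>_def)
    also have "(g ^^ nat (- n)) x = \<phi> n"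
      using that by (cases "n = 0") (simp_all add: \<phi>_def)
    finally show ?thesis .
  qed
  have "\<phi> (i + 1) \<in> Pi_mv T V (\<phi> i)" for i
  proof (cases "i \<ge> 0")
    case True
    then show ?thesis
      using fstep f L by simp
  next
    case False
    then have "\<phi> i = g (\<phi> (i + 1))"
      using gstep [of "i + 1"] by simp
    then show ?thesis
      using g L by metis
  qed
  then have "full_solution T V \<phi>"
    by (simp add: full_solution_def)
  moreover have "(\<exists>s. s < m \<and> \<phi> s \<notin> mvclass V (\<phi> t)) \<and> (\<exists>s. s > m \<and> \<phi> s \<notin> mvclass V (\<phi> t))"
    if reg: "regular T (mvclass V (\<phi> t))" for t m
  proof
    \<comment> \<open>Beyond \<open>m\<close> and in the range governed by \<open>f\<close>, one of
      the times \<open>s\<close>, \<open>s + 1\<close>, \<open>s + 2\<close> lies outside the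
      class.\<close>
    define s where "s = max (m + 1) 0"
    have s: "s > m" "s \<ge> 0"
      by (auto simp: s_def)
    show "\<exists>s. s > m \<and> \<phi> s \<notin> mvclass V (\<phi> t)"
    proof (cases "\<phi> s \<in> mvclass V (\<phi> t)")
      case True
      then have "mvclass V (\<phi> s) = mvclass V (\<phi> t)"
        using same L by blast
      moreover have "\<phi> (s + 1) = f (\<phi> s)" "\<phi> (s + 2) = f (f (\<phi> s))"
        using fstep [of s] fstep [of "s + 1"] s by (simp_all add: add.assoc)
      ultimately have "\<phi> (s + 1) \<notin> mvclass V (\<phi> t) \<or> \<phi> (s + 2) \<notin> mvclass V (\<phi> t)"
        using ff [OF L, of s] reg by simp
      moreover have "s + 1 > m" "s + 2 > m"
        using s by auto
      ultimately show ?thesis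
        by blast
    qed (use s in blast)
  next
    define s where "s = min (m - 1) 0"
    have s: "s < m" "s \<le> 0"
      by (auto simp: s_def)
    show "\<exists>s. s < m \<and> \<phi> s \<notin> mvclass V (\<phi> t)"
    proof (cases "\<phi> s \<in> mvclass V (\<phi> t)")
      case True
      then have "mvclass V (\<phi> s) = mvclass V (\<phi> t)"
        using same L by blast
      moreover have "\<phi> (s - 1) = g (\<phi> s)" "\<phi> (s - 2) = g (g (\<phi> s))"
        using gstep [of s] gstep [of "s - 1"] s by simp_all
      ultimately have "\<phi> (s - 1) \<notin> mvclass V (\<phi> t) \<or> \<phi> (s - 2) \<notin> mvclass V (\<phi> t)"
        using gg [OF L, of s] reg by simp
      moreover have "s - 1 < m" "s - 2 < m"
        using s by auto
      ultimately show ?thesis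
        by blast
    qed (use s in blast)
  qed
  ultimately have "essential_solution T V \<phi>"
    by (simp add: essential_solution_def)
  moreover have "range \<phi> \<subseteq> L"
    using L by blast
  moreover have "\<phi> 0 = x"
    by (simp add: \<phi>_def)
  ultimately show "x \<in> Inv T V L"
    unfolding Inv_def using x by blast
qed

text \<open>Two steps are needed because the arrow leaving a multivector may start at another of its points:
  first move there, then leave.\<close>

lemma leaving_map:
  assumes mv: "multivector_field T V" and LT: "L \<subseteq> topspace T"
    and compat: "\<And>W. \<lbrakk>W \<in> V; W \<inter> L \<noteq> {}\<rbrakk> \<Longrightarrow> W \<subseteq> L"
    and leave: "\<And>W. \<lbrakk>W \<in> V; W \<subseteq> L; regular T W\<rbrakk> \<Longrightarrow> \<exists>y\<in>W. \<exists>z\<in>L - W. R y z"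
  obtains f where "\<And>x. x \<in> L \<Longrightarrow> f x \<in> L"
    "\<And>x. x \<in> L \<Longrightarrow> f x \<in> mvclass V x \<or> R x (f x)"
    "\<And>x. \<lbrakk>x \<in> L; regular T (mvclass V x)\<rbrakk> \<Longrightarrow> f x \<notin> mvclass V x \<or> f (f x) \<notin> mvclass V x"
proof -
  note mvc = mvclass_eq [OF mv] mvclass_in [OF mv] in_mvclass [OF mv]
  obtain e z where ez: "\<And>W. \<lbrakk>W \<in> V; W \<subseteq> L; regular T W\<rbrakk> \<Longrightarrow> e W \<in> W \<and> z W \<in> L - W \<and> R (e W) (z W)"
    using leave by metis
  \<comment> \<open>Critical classes may be occupied forever, so \<open>f\<close> rests there. In a
    regular class it goes to the exit point \<open>e W\<close>, and from there out to
    \<open>z W\<close>.\<close>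
  define f where "f x = (let W = mvclass V x in if \<not> regular T W then x else if x = e W then z W else e W)" for x
  have W: "mvclass V x \<in> V" "x \<in> mvclass V x" "mvclass V x \<subseteq> L" if "x \<in> L" for x
    using that mvc LT compat by blast+
  have leaves: "f (e W) = z W" if "W \<in> V" "W \<subseteq> L" "regular T W" for W
    using mvc(1) [of W "e W"] ez [OF that] that by (simp add: f_def)
  show thesis
  proof (rule that)
    fix x
    assume x: "x \<in> L"
    note Wx = W [OF x]
    show "f x \<in> L"
      using ez [OF Wx(1,3)] Wx x by (auto simp: f_def Let_def)
    show "f x \<in> mvclass V x \<or> R x (f x)"
      using ez [OF Wx(1,3)] Wx x by (auto simp: f_def Let_def)
    assume reg: "regular T (mvclass V x)"
    show "f x \<notin> mvclass V x \<or> f (f x) \<notin> mvclass V x"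
    proof (cases "x = e (mvclass V x)")
      case True
      then show ?thesis
        using ez [OF Wx(1,3) reg] leaves [OF Wx(1,3) reg] by (metis DiffE)
    next
      case False
      then have "f x = e (mvclass V x)"
        using reg by (simp add: f_def)
      then show ?thesis
        using ez [OF Wx(1,3) reg] leaves [OF Wx(1,3) reg] by simp
    qed
  qed
qed

text \<open>Arrows of \<open>Pi_mv\<close> leaving or entering \<open>W\<close> come from closures only, since \<open>mvclass\<close> stays inside \<open>W\<close>.\<close>

definition removable :: "'a topology \<Rightarrow> 'a set \<Rightarrow> 'a set \<Rightarrow> bool" where
  "removable T L W \<longleftrightarrow> regular T W \<and> W \<subseteq> L \<and>
     ((\<forall>x\<in>W. T closure_of {x} \<inter> (L - W) = {}) \<or> (\<forall>x\<in>L - W. T closure_of {x} \<inter> W = {}))"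

text \<open>If nothing is removable, every regular class in \<open>L\<close> has an arrow out and an
  arrow in. Applying \<open>leaving_map\<close> to the closure relation and to its converse gives
  the two maps for \<open>subset_Inv\<close>.\<close>

lemma Inv_eq_self:
  assumes mv: "multivector_field T V" and LT: "L \<subseteq> topspace T"
    and compat: "\<And>W. \<lbrakk>W \<in> V; W \<inter> L \<noteq> {}\<rbrakk> \<Longrightarrow> W \<subseteq> L"
    and none: "\<And>W. W \<in> V \<Longrightarrow> \<not> removable T L W"
  shows "Inv T V L = L"
proof
  show "Inv T V L \<subseteq> L"
    by (auto simp: Inv_def)
  note mvc = mvclass_eq [OF mv] mvclass_in [OF mv] in_mvclass [OF mv]
  have same: "mvclass V y = mvclass V x" if "x \<in> L" "y \<in> mvclass V x" for x y
    using mvc that LT by blast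
  have "\<exists>y\<in>W. \<exists>z\<in>L - W. z \<in> T closure_of {y}" if "W \<in> V" "W \<subseteq> L" "regular T W" for W
    using none [OF that(1)] that unfolding removable_def by blast
  from leaving_map [OF mv LT compat this]
  obtain f where f: "\<And>x. x \<in> L \<Longrightarrow> f x \<in> L" "\<And>x. x \<in> L \<Longrightarrow> f x \<in> mvclass V x \<or> f x \<in> T closure_of {x}"
    "\<And>x. \<lbrakk>x \<in> L; regular T (mvclass V x)\<rbrakk> \<Longrightarrow> f x \<notin> mvclass V x \<or> f (f x) \<notin> mvclass V x"
    by blast
  have "\<exists>y\<in>W. \<exists>z\<in>L - W. y \<in> T closure_of {z}" if "W \<in> V" "W \<subseteq> L" "regular T W" for W
    using none [OF that(1)] that unfolding removable_def by blast
  from leaving_map [OF mv LT compat this]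
  obtain g where g: "\<And>x. x \<in> L \<Longrightarrow> g x \<in> L" "\<And>x. x \<in> L \<Longrightarrow> g x \<in> mvclass V x \<or> x \<in> T closure_of {g x}"
    "\<And>x. \<lbrakk>x \<in> L; regular T (mvclass V x)\<rbrakk> \<Longrightarrow> g x \<notin> mvclass V x \<or> g (g x) \<notin> mvclass V x"
    by blast
  show "L \<subseteq> Inv T V L"
  proof (rule subset_Inv)
    show "f x \<in> L \<and> f x \<in> Pi_mv T V x" if "x \<in> L" for x
      using f(1,2) [OF that] by (auto simp: Pi_mv_def)
    show "g x \<in> L \<and> x \<in> Pi_mv T V (g x)" if "x \<in> L" for x
      using g(1,2) [OF that] same [OF that, of "g x"] mvc(3) [of x] LT that by (auto simp: Pi_mv_def)
  qed (fact f(3) g(3) | erule (1) same)+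
qed

section \<open>Effect of a removal on the invariant part and on homology\<close>

lemma Inv_mono: "A \<subseteq> B \<Longrightarrow> Inv T V A \<subseteq> Inv T V B"
  by (auto simp: Inv_def intro: order_trans)

text \<open>A solution in \<open>L\<close> that meets \<open>W\<close> stays there for all later
  times if \<open>W\<close> has no exit, and was there at all earlier times if \<open>W\<close> has
  no entrance. Either contradicts essentiality, as \<open>W\<close> is regular.\<close>

lemma Inv_removable:
  assumes mv: "multivector_field T V" and LT: "L \<subseteq> topspace T" and W: "W \<in> V" and rem: "removable T L W"
  shows "Inv T V (L - W) = Inv T V L"
proof
  show "Inv T V (L - W) \<subseteq> Inv T V L"
    by (rule Inv_mono) auto
  have "range \<phi> \<subseteq> L - W" if ess: "essential_solution T V \<phi>" and \<phi>: "range \<phi> \<subseteq> L" for \<phi>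
  proof -
    have "\<phi> t \<notin> W" for t
    proof
      assume t: "\<phi> t \<in> W"
      then have class_t: "mvclass V (\<phi> t) = W"
        using mvclass_eq [OF mv W] by blast
      have succ: "\<phi> (i + 1) \<in> mvclass V (\<phi> i) \<union> T closure_of {\<phi> i}" for i
        using ess by (simp add: essential_solution_def full_solution_def Pi_mv_def)
      have L: "\<phi> i \<in> L" for i
        using \<phi> by auto
      have "regular T W"
        using rem by (simp add: removable_def)
      then have escapes: "\<exists>s<t. \<phi> s \<notin> W" "\<exists>s>t. \<phi> s \<notin> W"
        using ess class_t unfolding essential_solution_def by metis+
      consider (bottom) "\<forall>x\<in>W. T closure_of {x} \<inter> (L - W) = {}"
        | (top) "\<forall>x\<in>L - W. T closure_of {x} \<inter> W = {}"
        using rem unfolding removable_def by blast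
      then show False
      proof cases
        case bottom
        have "\<phi> s \<in> W" if "t \<le> s" for s
          using that
        proof (induction rule: int_ge_induct)
          case (step i)
          have "mvclass V (\<phi> i) = W"
            using mvclass_eq [OF mv W] step by blast
          then show ?case
            using succ [of i] bottom step L by blast
        qed (rule t)
        then show False
          using escapes by force
      next
        case top
        have "\<phi> s \<in> W" if "s \<le> t" for s
          using that
        proof (induction rule: int_le_induct)
          case (step i)
          have "\<phi> i \<in> mvclass V (\<phi> (i - 1)) \<union> T closure_of {\<phi> (i - 1)}"
            using succ [of "i - 1"] by simp
          moreover have "\<phi> (i - 1) \<in> W" if "\<phi> i \<in> mvclass V (\<phi> (i - 1))"
          proof -
            have "\<phi> (i - 1) \<in> topspace T"
              using L LT by blast
            then have "mvclass V (\<phi> (i - 1)) = mvclass V (\<phi> i)"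
              using mvclass_eq [OF mv mvclass_in [OF mv]] that by metis
            also have "\<dots> = W"
              using mvclass_eq [OF mv W] step by blast
            finally show ?thesis
              using in_mvclass [OF mv \<open>\<phi> (i - 1) \<in> topspace T\<close>] by simp
          qed
          ultimately show ?case
            using top step L by blast
        qed (rule t)
        then show False
          using escapes by force
      qed
    qed
    then show ?thesis
      using \<phi> by blast
  qed
  then show "Inv T V L \<subseteq> Inv T V (L - W)"
    unfolding Inv_def by blast
qed

lemma homology_eq_Inv:
  assumes fin: "finite (topspace T)" and t0: "t0_space T" and mv: "multivector_field T V"
    and "closedin T P" "closedin T Q" "Q \<subseteq> P"
    and "\<And>W. \<lbrakk>W \<in> V; W \<inter> (P - Q) \<noteq> {}\<rbrakk> \<Longrightarrow> W \<subseteq> P - Q"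
  shows "relative_homology_group p (subtopology T P) Q
     \<cong> relative_homology_group p (subtopology T (T closure_of (Inv T V (P - Q)))) (mouth T (Inv T V (P - Q)))"
  using assms(4-)
proof (induction "card (P - Q)" arbitrary: P Q rule: less_induct)
  case less
  let ?L = "P - Q"
  let ?h = "\<lambda>P. relative_homology_group p (subtopology T P)"
  have PT: "P \<subseteq> topspace T"
    using less.prems(1) closedin_subset by blast
  then have LT: "?L \<subseteq> topspace T"
    by blast
  show ?case
  proof (cases "\<exists>W\<in>V. removable T ?L W")
    case False
    then have "Inv T V ?L = ?L"
      using Inv_eq_self [OF mv LT] less.prems(4) by blast
    then show ?thesis
      using homology_locally_closed [OF fin t0 less.prems(1-3)] by (simp add: group.iso_sym)
  next
    case True
    then obtain W where W: "W \<in> V" and rem: "removable T ?L W"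
      by blast
    have regW: "regular T W" and WL: "W \<subseteq> ?L"
      using rem by (auto simp: removable_def)
    have "W \<noteq> {}"
      using mv W by (auto simp: multivector_field_def multivector_def)
    have card: "card (?L - W) < card ?L"
      using \<open>W \<noteq> {}\<close> WL finite_subset [OF LT fin] by (intro psubset_card_mono) auto
    have compat: "A \<subseteq> ?L - W" if "A \<in> V" "A \<inter> (?L - W) \<noteq> {}" for A
      using that less.prems(4) [of A] mv W unfolding multivector_field_def by blast
    have inv: "Inv T V (?L - W) = Inv T V ?L"
      by (rule Inv_removable [OF mv LT W rem])
    \<comment> \<open>Any closed pair with difference \<open>W\<close> has the homology of (cl
      \<open>W\<close>, mo \<open>W\<close>), which vanishes since \<open>W\<close> is
      regular.\<close>
    have triv: "trivial_group (relative_homology_group q (subtopology T A) B)"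
      if "closedin T A" "closedin T B" "B \<subseteq> A" "A - B = W" for A B q
      using isomorphic_group_triviality1 [OF homology_locally_closed [OF fin t0 that(1-3)]] regW that(4)
      by (simp add: regular_def critical_def)
    have closed: "closedin T A" if A: "A \<subseteq> topspace T" "\<And>x. x \<in> A \<Longrightarrow> T closure_of {x} \<subseteq> A" for A
    proof -
      have "T closure_of A = (\<Union>x\<in>A. T closure_of {x})"
        using closure_of_Union [of "(\<lambda>x. {x}) ` A" T] finite_subset [OF A(1) fin] by auto
      then show ?thesis
        using A by (auto simp: closure_of_subset_eq [symmetric])
    qed
    have clP: "T closure_of {x} \<subseteq> P" if "x \<in> P" for x
      using that less.prems(1) by (simp add: closure_of_minimal)
    have clQ: "T closure_of {x} \<subseteq> Q" if "x \<in> Q" for x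
      using that less.prems(2) by (simp add: closure_of_minimal)
    from rem consider (bottom) "\<forall>x\<in>W. T closure_of {x} \<inter> (?L - W) = {}"
      | (top) "\<forall>x\<in>?L - W. T closure_of {x} \<inter> W = {}"
      unfolding removable_def by blast
    then show ?thesis
    proof cases
      case bottom
      let ?Q = "Q \<union> W"
      \<comment> \<open>Closures of points of \<open>W\<close> stay in \<open>P\<close> and miss
        \<open>?L - W\<close>, so they lie in \<open>?Q\<close>.\<close>
      have Q: "closedin T ?Q"
        using clP clQ bottom WL PT less.prems(3) by (intro closed) blast+
      have QP: "?Q \<subseteq> P" "P - ?Q = ?L - W" "?Q - Q = W" "P \<inter> ?Q = ?Q"
        using WL less.prems(3) by auto
      have "?h P ?Q \<cong> relative_homology_group p (subtopology T (T closure_of (Inv T V ?L))) (mouth T (Inv T V ?L))"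
        using less.hyps [of P ?Q] card compat Q QP less.prems(1) inv by simp
      moreover have "?h P Q \<cong> ?h P ?Q"
        using iso_homology_triple_trivial_lower [of Q ?Q "subtopology T P" p]
          triv [OF Q less.prems(2)] QP by (simp add: subtopology_subtopology)
      ultimately show ?thesis
        by (rule iso_trans [rotated])
    next
      case top
      let ?P = "P - W"
      \<comment> \<open>No closure of a point of \<open>?P\<close> reaches \<open>W\<close>: points
        of \<open>Q\<close> have closure in \<open>Q\<close>, and the others are covered by
        \<open>top\<close>.\<close>
      have P: "closedin T ?P"
        using clP clQ top WL PT less.prems(3) by (intro closed) blast+
      have PQ: "Q \<subseteq> ?P" "?P - Q = ?L - W" "P - ?P = W" "P \<inter> ?P = ?P"
        using WL less.prems(3) by auto
      have "?h ?P Q \<cong> relative_homology_group p (subtopology T (T closure_of (Inv T V ?L))) (mouth T (Inv T V ?L))"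
        using less.hyps [of ?P Q] card compat P PQ less.prems(2) inv by simp
      moreover have "?h ?P Q \<cong> ?h P Q"
        using iso_homology_triple_trivial_upper [of Q ?P "subtopology T P" p]
          triv [OF less.prems(1) P] PQ by (simp add: subtopology_subtopology)
      then have "?h P Q \<cong> ?h ?P Q"
        by (simp add: group.iso_sym)
      ultimately show ?thesis
        by (rule iso_trans [rotated])
    qed
  qed
qed

text \<open>All points of \<open>W\<close> are reachable from one another under
  \<open>Pi_mv\<close>. By (IP2) a point of \<open>W\<close> outside \<open>P\<close> would force
  \<open>x\<close> into \<open>Q\<close>; by (IP1) so would a point of \<open>W\<close> in
  \<open>Q\<close>.\<close>

lemma index_pair_compatible:
  assumes mv: "multivector_field T V" and ip: "index_pair T V S P Q"
    and W: "W \<in> V" "W \<inter> (P - Q) \<noteq> {}"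
  shows "W \<subseteq> P - Q"
proof -
  obtain x where x: "x \<in> W" "x \<in> P - Q"
    using W by blast
  have W_Pi: "W \<subseteq> Pi_mv T V y" if "y \<in> W" for y
    using mvclass_eq [OF mv W(1) that] by (auto simp: Pi_mv_def)
  then have WP: "W \<subseteq> P"
    using x ip unfolding index_pair_def by blast
  then show ?thesis
    using W_Pi x ip unfolding index_pair_def by blast
qed

theorem theorem5p18:
  fixes T :: "'a topology" and V :: "'a set set" and S P1 P2 Q1 Q2 :: "'a set"
  assumes "finite (topspace T)" and "t0_space T"
    and "multivector_field T V"
    and "isolated_invariant_set T V S"
    and "index_pair T V S P1 P2" and "index_pair T V S Q1 Q2"
  shows "\<forall>p. relative_homology_group p (subtopology T P1) P2
             \<cong> relative_homology_group p (subtopology T Q1) Q2"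
proof
  fix p
  \<comment> \<open>By (IP3) the invariant part of \<open>P - Q\<close> is \<open>S\<close>, so the
    group compared with is the same for every index pair.\<close>
  have "relative_homology_group p (subtopology T P) Q
      \<cong> relative_homology_group p (subtopology T (T closure_of S)) (mouth T S)"
    if "index_pair T V S P Q" for P Q
    using homology_eq_Inv [OF assms(1-3), of P Q p] index_pair_compatible [OF assms(3) that] that
    unfolding index_pair_def by simp
  from this [OF assms(5)] this [OF assms(6)]
  show "relative_homology_group p (subtopology T P1) P2 \<cong> relative_homology_group p (subtopology T Q1) Q2"
    using iso_trans group.iso_sym group_relative_homology_group by metis
qed

end
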